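(* Let $C$ be a signed cycle. Let $N_1,\dots,N_k$ ($k\ge 0$) be the negative sections of $C$ of odd length, in cyclic order around $C$. For $i=1,\dots,k-1$ let $m_i$ be the number of positive edges of $C$ on the path between $N_i$ and $N_{i+1}$, and let $m_k$ be the number of positive edges between $N_k$ and $N_1$. Let $m_o=\sum_{i \text{ odd}} m_i$ and $m_e=\sum_{i\text{ even}} m_i$. Then $C$ is a parity signed graph if and only if $k$ is even and either (1) $k=0$ and either $C$ has even length and all its edges are negative, or $C$ has odd length and has exactly one positive edge; or (2) $k>0$ and $|m_o-m_e|\le 1$.
   Context: A signed graph is a pair $S=(G,\sigma)$ with $G$ a graph and $\sigma:E(G)\to\{+,-\}$. For a graph $G$ with $n$ vertices and a bijection $f:V(G)\to\{1,\dots,n\}$, define $\sigma_f(uv)=+$ if $f(u),f(v)$ have the same parity and $\sigma_f(uv)=-$ otherwise. $S$ is a parity signed graph if $\sigma=\sigma_f$ for some such bijection $f$. A positive (negative) section of a signed graph is a maximal connected subgraph all of whose edges are positive (negative). In a cycle, a section is a path unless it is the whole cycle; a section is odd or even according to the parity of its length (number of edges). *)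

theory Defs
  imports Main
begin

datatype sign = Positive | Negative

record 'a graph =
  verts :: "'a set"
  edges :: "'a set set"

text \<open>Only the values of \<open>edge_sign\<close> on \<open>edges\<close> are meaningful.\<close>

record 'a signed_graph = "'a graph" +
  edge_sign :: "'a set \<Rightarrow> sign"

definition simple_graph :: "('a, 'b) graph_scheme \<Rightarrow> bool" where
  "simple_graph G \<longleftrightarrow>
     finite (verts G) \<and> (\<forall>e\<in>edges G. e \<subseteq> verts G \<and> card e = 2)"

definition subgraph :: "('a, 'b) graph_scheme \<Rightarrow> ('a, 'c) graph_scheme \<Rightarrow> bool" where
  "subgraph H G \<longleftrightarrow> simple_graph H \<and> verts H \<subseteq> verts G \<and> edges H \<subseteq> edges G"

definition connected_graph :: "('a, 'b) graph_scheme \<Rightarrow> bool" where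
  "connected_graph G \<longleftrightarrow>
     verts G \<noteq> {} \<and>
     (\<forall>u\<in>verts G. \<forall>v\<in>verts G. (u, v) \<in> {(x, y). {x, y} \<in> edges G}\<^sup>*)"

definition graph_length :: "('a, 'b) graph_scheme \<Rightarrow> nat" where
  "graph_length G = card (edges G)"

definition cycle_edges :: "'a list \<Rightarrow> 'a set list" where
  "cycle_edges vs = map (\<lambda>i. {vs ! i, vs ! (Suc i mod length vs)}) [0..<length vs]"

text \<open>\<open>vs\<close> lists the vertices of the cycle in the order met when going once around it,
  in either direction, from an arbitrary starting vertex.\<close>

definition traversal :: "('a, 'b) graph_scheme \<Rightarrow> 'a list \<Rightarrow> bool" where
  "traversal G vs \<longleftrightarrow>
     length vs \<ge> 3 \<and> distinct vs \<and> set vs = verts G \<and> set (cycle_edges vs) = edges G"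

definition cycle_graph :: "('a, 'b) graph_scheme \<Rightarrow> bool" where
  "cycle_graph G \<longleftrightarrow> (\<exists>vs. traversal G vs)"

definition parity_sign :: "('a \<Rightarrow> nat) \<Rightarrow> 'a \<Rightarrow> 'a \<Rightarrow> sign" where
  "parity_sign f u v = (if even (f u) \<longleftrightarrow> even (f v) then Positive else Negative)"

definition parity_signed_graph :: "'a signed_graph \<Rightarrow> bool" where
  "parity_signed_graph S \<longleftrightarrow>
     simple_graph S \<and>
     (\<exists>f. bij_betw f (verts S) {1..card (verts S)} \<and>
          (\<forall>u v. {u, v} \<in> edges S \<longrightarrow> edge_sign S {u, v} = parity_sign f u v))"

definition homogeneous_subgraph :: "sign \<Rightarrow> 'a signed_graph \<Rightarrow> 'a graph \<Rightarrow> bool" where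
  "homogeneous_subgraph s S H \<longleftrightarrow>
     subgraph H S \<and> connected_graph H \<and> (\<forall>e\<in>edges H. edge_sign S e = s)"

text \<open>A vertex incident with no edge of sign \<open>s\<close> forms a section of length 0, which is even.\<close>

definition signed_section :: "sign \<Rightarrow> 'a signed_graph \<Rightarrow> 'a graph \<Rightarrow> bool" where
  "signed_section s S H \<longleftrightarrow>
     homogeneous_subgraph s S H \<and>
     (\<forall>H'. homogeneous_subgraph s S H' \<and> subgraph H H' \<longrightarrow> H' = H)"

definition odd_negative_sections :: "'a signed_graph \<Rightarrow> 'a graph set" where
  "odd_negative_sections S = {H. signed_section Negative S H \<and> odd (graph_length H)}"

text \<open>Going once around the cycle, one traverses \<open>N 1\<close>, \<open>P 1\<close>, \<open>N 2\<close>, \<open>P 2\<close>, \dots,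
  \<open>N k\<close>, \<open>P k\<close> in this order; so \<open>P i\<close> is the sequence of edges of the path between \<open>N i\<close>
  and \<open>N (i + 1)\<close>, and \<open>P k\<close> that of the path between \<open>N k\<close> and \<open>N 1\<close>.  The lists \<open>A i\<close>
  enumerate the edges of \<open>N i\<close> in the order of traversal.\<close>

definition in_cyclic_order ::
    "('a, 'b) graph_scheme \<Rightarrow> nat \<Rightarrow> (nat \<Rightarrow> 'a graph) \<Rightarrow> (nat \<Rightarrow> 'a set list) \<Rightarrow> bool" where
  "in_cyclic_order G k N P \<longleftrightarrow>
     (\<exists>vs A. traversal G vs \<and>
             (\<forall>i\<in>{1..k}. set (A i) = edges (N i)) \<and>
             cycle_edges vs = concat (map (\<lambda>i. A i @ P i) [1..<Suc k]))"

definition positive_edges :: "'a signed_graph \<Rightarrow> 'a set set" where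
  "positive_edges S = {e \<in> edges S. edge_sign S e = Positive}"

end

theory Submission
  imports Defs
begin

text \<open>A parity labelling amounts to a two-colouring of the vertices in which exactly the negative
  edges change colour and the two colour classes differ in size by at most one. Such a colouring of
  a cycle exists iff the number of negative edges, and hence the number of odd negative sections, is
  even. Averaging the colours \<open>\<plusminus>1\<close> over the ends of every edge, the difference of the class sizes
  becomes the sum of the colours of the positive edges. That colour is constant
  between consecutive odd negative sections, because even sections do not change it, and flips
  across each odd one; so the difference is \<open>\<plusminus>(m\<^sub>o - m\<^sub>e)\<close>, or the number of positive edges when
  there is no odd section.\<close>

definition neg_count :: "sign list \<Rightarrow> nat" where
  "neg_count xs = length (filter (\<lambda>s. s = Negative) xs)"

definition pos_count :: "sign list \<Rightarrow> nat" where
  "pos_count xs = length (filter (\<lambda>s. s = Positive) xs)"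

text \<open>The sum of the colours of the positive edges along a walk that starts in colour \<open>1\<close>.\<close>

fun signed_pos_count :: "sign list \<Rightarrow> int" where
  "signed_pos_count [] = 0"
| "signed_pos_count (Positive # xs) = 1 + signed_pos_count xs"
| "signed_pos_count (Negative # xs) = - signed_pos_count xs"

lemma neg_count_simps [simp]:
  "neg_count [] = 0"
  "neg_count (Positive # xs) = neg_count xs"
  "neg_count (Negative # xs) = Suc (neg_count xs)"
  "neg_count (xs @ ys) = neg_count xs + neg_count ys"
  "neg_count (replicate r Negative) = r"
  by (auto simp: neg_count_def)

lemma pos_count_simps [simp]:
  "pos_count [] = 0"
  "pos_count (Positive # xs) = Suc (pos_count xs)"
  "pos_count (Negative # xs) = pos_count xs"
  "pos_count (xs @ ys) = pos_count xs + pos_count ys"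
  "pos_count (replicate r Negative) = 0"
  by (auto simp: pos_count_def)

lemma pos_count_plus_neg_count: "pos_count xs + neg_count xs = length xs"
proof (induction xs)
  case (Cons x xs)
  then show ?case by (cases x) auto
qed simp

lemma signed_pos_count_append [simp]:
  "signed_pos_count (xs @ ys) = signed_pos_count xs + (-1) ^ neg_count xs * signed_pos_count ys"
proof (induction xs)
  case (Cons x xs)
  then show ?case by (cases x) auto
qed simp

lemma signed_pos_count_replicate [simp]: "signed_pos_count (replicate r Negative) = 0"
  by (induction r) auto

lemma sum_alternating_eq_signed_pos_count:
  "2 * (\<Sum>j<length xs. (-1) ^ neg_count (take j xs)) =
     2 * signed_pos_count xs + 1 - (-1 :: int) ^ neg_count xs"
proof (induction xs rule: rev_induct)
  case (snoc x xs)
  then show ?case by (cases x) auto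
qed simp

lemma even_gaps_counts:
  assumes "xs \<noteq> [] \<Longrightarrow> hd xs = Positive \<and> last xs = Positive"
    and "\<And>us r vs. xs = us @ Positive # replicate r Negative @ Positive # vs \<Longrightarrow> even r"
  shows "even (neg_count xs) \<and> signed_pos_count xs = int (pos_count xs)"
  using assms
proof (induction xs rule: length_induct)
  case (1 xs)
  show ?case
  proof (cases xs)
    case (Cons x ys)
    then have x: "x = Positive" using 1(2) by simp
    define r where "r = length (takeWhile (\<lambda>s. s = Negative) ys)"
    define zs where "zs = dropWhile (\<lambda>s. s = Negative) ys"
    have tw: "takeWhile (\<lambda>s. s = Negative) ys = replicate r Negative"
      unfolding r_def by (rule replicate_eqI) (auto dest: set_takeWhileD)
    have ys: "ys = replicate r Negative @ zs"
      unfolding zs_def tw[symmetric] by simp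
    show ?thesis
    proof (cases zs)
      case Nil
      then have "r = 0" using 1(2) Cons ys x by (cases r) (auto split: if_splits)
      then show ?thesis using Cons ys x Nil by simp
    next
      case (Cons z zs')
      have "z = Positive"
        using hd_dropWhile[of "\<lambda>s. s = Negative" ys] Cons unfolding zs_def
        by (cases z) auto
      then have xs: "xs = Positive # replicate r Negative @ zs" and zs: "zs = Positive # zs'"
        using \<open>xs = x # ys\<close> x ys Cons by auto
      have r: "even r" using 1(3)[of "[]" r zs'] xs zs by simp
      have "even (neg_count zs) \<and> signed_pos_count zs = int (pos_count zs)"
      proof (rule 1(1)[rule_format])
        show "length zs < length xs" using xs by simp
        show "hd zs = Positive \<and> last zs = Positive" using 1(2) xs zs by auto
        show "even r'" if "zs = us @ Positive # replicate r' Negative @ Positive # vs" for us r' vs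
          using 1(3)[of "Positive # replicate r Negative @ us" r' vs] xs that by simp
      qed
      then show ?thesis using xs r by simp
    qed
  qed simp
qed

definition cyc_vertex :: "'a list \<Rightarrow> nat \<Rightarrow> 'a" where
  "cyc_vertex vs i = vs ! (i mod length vs)"

definition cyc_edge :: "'a list \<Rightarrow> nat \<Rightarrow> 'a set" where
  "cyc_edge vs i = {cyc_vertex vs i, cyc_vertex vs (Suc i)}"

lemma cycle_edges_eq: "cycle_edges vs = map (cyc_edge vs) [0..<length vs]"
  by (auto simp: cycle_edges_def cyc_edge_def cyc_vertex_def)

lemma length_cycle_edges [simp]: "length (cycle_edges vs) = length vs"
  by (simp add: cycle_edges_eq)

lemma nth_cycle_edges: "i < length vs \<Longrightarrow> cycle_edges vs ! i = cyc_edge vs i"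
  by (simp add: cycle_edges_eq)

lemma cyc_vertex_mod [simp]: "cyc_vertex vs (i mod length vs) = cyc_vertex vs i"
  by (simp add: cyc_vertex_def)

lemma cyc_edge_mod [simp]: "cyc_edge vs (i mod length vs) = cyc_edge vs i"
  by (simp add: cyc_edge_def cyc_vertex_def mod_Suc_eq)

lemma cycle_edges_rotate1: "cycle_edges (rotate1 vs) = rotate1 (cycle_edges vs)"
proof (rule nth_equalityI)
  fix i assume i: "i < length (cycle_edges (rotate1 vs))"
  then have "length vs > 0" and "i < length vs" by auto
  then have "cycle_edges (rotate1 vs) ! i = cyc_edge vs (Suc i)"
    by (simp add: cycle_edges_def nth_rotate1 cyc_edge_def cyc_vertex_def mod_Suc_eq)
  also have "\<dots> = rotate1 (cycle_edges vs) ! i"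
    using \<open>i < length vs\<close> \<open>length vs > 0\<close>
    by (simp add: nth_rotate1 nth_cycle_edges[OF mod_less_divisor])
  finally show "cycle_edges (rotate1 vs) ! i = rotate1 (cycle_edges vs) ! i" .
qed simp

lemma traversal_rotate: "traversal G vs \<Longrightarrow> traversal G (rotate p vs)"
proof (induction p)
  case (Suc p)
  then show ?case by (simp add: traversal_def cycle_edges_rotate1)
qed simp

lemma cycle_edges_rotate: "cycle_edges (rotate p vs) = rotate p (cycle_edges vs)"
  by (induction p) (simp_all add: cycle_edges_rotate1)

context
  fixes G :: "('a, 'b) graph_scheme" and vs :: "'a list"
  assumes trav: "traversal G vs"
begin

lemma cyc_vertex_eq_iff: "cyc_vertex vs i = cyc_vertex vs j \<longleftrightarrow> i mod length vs = j mod length vs"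
proof -
  have "i mod length vs < length vs" "j mod length vs < length vs" "distinct vs"
    using trav by (auto simp: traversal_def intro!: mod_less_divisor)
  then show ?thesis by (simp add: cyc_vertex_def nth_eq_iff_index_eq)
qed

lemma Suc_mod_neq: "Suc i mod length vs \<noteq> i mod length vs"
  using trav by (auto simp: traversal_def mod_Suc)

lemma Suc_Suc_mod_neq: "Suc (Suc i) mod length vs \<noteq> i mod length vs"
  using trav by (auto simp: traversal_def mod_Suc)

lemma cyc_edge_eq_iff: "cyc_edge vs i = cyc_edge vs j \<longleftrightarrow> i mod length vs = j mod length vs"
proof
  assume eq: "cyc_edge vs i = cyc_edge vs j"
  show "i mod length vs = j mod length vs"
  proof (rule ccontr)
    assume "i mod length vs \<noteq> j mod length vs"
    then have "i mod length vs = Suc j mod length vs" "Suc i mod length vs = j mod length vs"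
      using eq by (auto simp: cyc_edge_def doubleton_eq_iff cyc_vertex_eq_iff)
    then have "Suc (Suc i) mod length vs = i mod length vs"
      by (metis mod_Suc_eq)
    then show False using Suc_Suc_mod_neq by blast
  qed
next
  assume "i mod length vs = j mod length vs"
  then show "cyc_edge vs i = cyc_edge vs j" by (metis cyc_edge_mod)
qed

lemma distinct_cycle_edges: "distinct (cycle_edges vs)"
  by (auto simp: cycle_edges_eq distinct_map inj_on_def cyc_edge_eq_iff)

lemma card_cyc_edge: "card (cyc_edge vs i) = 2"
  using Suc_mod_neq[of i] by (auto simp: cyc_edge_def card_2_iff doubleton_eq_iff cyc_vertex_eq_iff)

lemma length_traversal: "length vs > 0"
  using trav by (auto simp: traversal_def)

lemma verts_traversal: "verts G = cyc_vertex vs ` {..<length vs}"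
proof -
  have "verts G = set vs" using trav by (simp add: traversal_def)
  also have "\<dots> = cyc_vertex vs ` {..<length vs}"
    by (force simp: set_conv_nth cyc_vertex_def)
  finally show ?thesis .
qed

lemma cyc_vertex_in_verts: "cyc_vertex vs i \<in> verts G"
  using length_traversal by (metis cyc_vertex_mod verts_traversal imageI lessThan_iff mod_less_divisor)

lemma edges_traversal: "edges G = cyc_edge vs ` {..<length vs}"
proof -
  have "edges G = set (cycle_edges vs)" using trav by (simp add: traversal_def)
  then show ?thesis by (auto simp: cycle_edges_eq)
qed

lemma cyc_edge_in_edges: "cyc_edge vs i \<in> edges G"
  using length_traversal by (metis cyc_edge_mod edges_traversal imageI lessThan_iff mod_less_divisor)

lemma simple_graph_traversal: "simple_graph G"
  by (auto simp: simple_graph_def verts_traversal edges_traversal card_cyc_edge[simplified])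
    (auto simp: cyc_edge_def cyc_vertex_in_verts verts_traversal[symmetric])

lemma card_edges_traversal: "card (edges G) = length vs"
  using distinct_card[OF distinct_cycle_edges] trav by (simp add: traversal_def)

lemma incident_edge_cases:
  assumes "d \<in> edges G" "cyc_vertex vs (Suc c) \<in> d"
  shows "d = cyc_edge vs c \<or> d = cyc_edge vs (Suc c)"
proof -
  obtain l where l: "d = cyc_edge vs l" using assms(1) by (auto simp: edges_traversal)
  then consider "Suc c mod length vs = l mod length vs" | "Suc c mod length vs = Suc l mod length vs"
    using assms(2) by (auto simp: cyc_edge_def cyc_vertex_eq_iff)
  then show ?thesis
  proof cases
    case 1
    then show ?thesis using l by (simp add: cyc_edge_eq_iff)
  next
    case 2
    then have "c mod length vs = l mod length vs"
      by (auto simp: mod_Suc split: if_splits)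
    then show ?thesis using l by (simp add: cyc_edge_eq_iff)
  qed
qed

end

lemma sum_alternating_interval:
  "(\<Sum>i\<in>{1..n}. (-1) ^ i) = (if even n then 0 else -1 :: int)"
  by (induction n) auto

lemma sum_signs_eq_card_diff:
  fixes \<chi> :: "'a \<Rightarrow> int"
  assumes "finite V" "\<And>v. v \<in> V \<Longrightarrow> \<chi> v = 1 \<or> \<chi> v = -1"
  shows "sum \<chi> V = int (card {v \<in> V. \<chi> v = 1}) - int (card {v \<in> V. \<chi> v = -1})"
    and "card V = card {v \<in> V. \<chi> v = 1} + card {v \<in> V. \<chi> v = -1}"
proof -
  have V: "V = {v \<in> V. \<chi> v = 1} \<union> {v \<in> V. \<chi> v = -1}" using assms(2) by auto
  have "sum \<chi> V = sum \<chi> {v \<in> V. \<chi> v = 1} + sum \<chi> {v \<in> V. \<chi> v = -1}"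
    by (subst V, rule sum.union_disjoint) (use assms(1) in auto)
  then show "sum \<chi> V = int (card {v \<in> V. \<chi> v = 1}) - int (card {v \<in> V. \<chi> v = -1})"
    by simp
  show "card V = card {v \<in> V. \<chi> v = 1} + card {v \<in> V. \<chi> v = -1}"
    by (subst V, rule card_Un_disjoint) (use assms(1) in auto)
qed

definition sign_colouring :: "'a signed_graph \<Rightarrow> ('a \<Rightarrow> int) \<Rightarrow> bool" where
  "sign_colouring S \<chi> \<longleftrightarrow>
     (\<forall>v\<in>verts S. \<chi> v = 1 \<or> \<chi> v = -1) \<and>
     (\<forall>u v. {u, v} \<in> edges S \<longrightarrow>
        \<chi> v = (if edge_sign S {u, v} = Positive then \<chi> u else - \<chi> u))"

lemma sign_colouring_uminus: "sign_colouring S \<chi> \<Longrightarrow> sign_colouring S (\<lambda>v. - \<chi> v)"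
  by (auto simp: sign_colouring_def)

lemma parity_signed_graph_iff_colouring:
  assumes "simple_graph S"
  shows "parity_signed_graph S \<longleftrightarrow> (\<exists>\<chi>. sign_colouring S \<chi> \<and> \<bar>sum \<chi> (verts S)\<bar> \<le> 1)"
proof
  assume "parity_signed_graph S"
  then obtain f where f: "bij_betw f (verts S) {1..card (verts S)}"
    and sg: "\<And>u v. {u, v} \<in> edges S \<Longrightarrow> edge_sign S {u, v} = parity_sign f u v"
    by (auto simp: parity_signed_graph_def)
  have "(\<Sum>v\<in>verts S. (-1 :: int) ^ f v) = (\<Sum>i\<in>{1..card (verts S)}. (-1) ^ i)"
    by (rule sum.reindex_bij_betw[OF f])
  then have "\<bar>\<Sum>v\<in>verts S. (-1 :: int) ^ f v\<bar> \<le> 1"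
    by (simp only: sum_alternating_interval) simp
  moreover have "sign_colouring S (\<lambda>v. (-1) ^ f v)"
    unfolding sign_colouring_def by (auto simp: sg parity_sign_def minus_one_power_iff)
  ultimately show "\<exists>\<chi>. sign_colouring S \<chi> \<and> \<bar>sum \<chi> (verts S)\<bar> \<le> 1" by blast
next
  assume "\<exists>\<chi>. sign_colouring S \<chi> \<and> \<bar>sum \<chi> (verts S)\<bar> \<le> 1"
  then obtain \<chi>0 where \<chi>0: "sign_colouring S \<chi>0" "\<bar>sum \<chi>0 (verts S)\<bar> \<le> 1" by blast
  obtain \<chi> where \<chi>: "sign_colouring S \<chi>" and sum: "sum \<chi> (verts S) \<in> {-1, 0}"
  proof (cases "sum \<chi>0 (verts S) = 1")
    case True
    then show ?thesis
      using that[of "\<lambda>v. - \<chi>0 v"] sign_colouring_uminus[OF \<chi>0(1)] by (simp add: sum_negf)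
  next
    case False
    then have "sum \<chi>0 (verts S) \<in> {-1, 0}" using \<chi>0(2) by (simp; linarith)
    then show ?thesis using that[of \<chi>0] \<chi>0 by blast
  qed
  let ?V = "verts S" and ?I = "{1..card (verts S)}"
  let ?g = "\<lambda>i. (-1 :: int) ^ i"
  have fin: "finite ?V" using assms by (simp add: simple_graph_def)
  have vals: "\<chi> v = 1 \<or> \<chi> v = -1" if "v \<in> ?V" for v
    using \<chi> that by (auto simp: sign_colouring_def)
  have gvals: "?g i = 1 \<or> ?g i = -1" for i by (simp add: minus_one_power_iff)
  have gsum: "sum ?g ?I \<in> {-1, 0}" by (simp only: sum_alternating_interval) simp
  note V = sum_signs_eq_card_diff[OF fin, of \<chi>, OF vals]
  note I = sum_signs_eq_card_diff[of ?I ?g, OF _ gvals]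
  have "card {v \<in> ?V. \<chi> v = 1} = card {i \<in> ?I. ?g i = 1}"
    and "card {v \<in> ?V. \<chi> v = -1} = card {i \<in> ?I. ?g i = -1}"
    using V I sum gsum by auto
  then have "\<exists>g. bij_betw g {v \<in> ?V. \<chi> v = 1} {i \<in> ?I. ?g i = 1}"
    and "\<exists>h. bij_betw h {v \<in> ?V. \<chi> v = -1} {i \<in> ?I. ?g i = -1}"
    using fin by (auto intro!: finite_same_card_bij)
  then obtain g h where g: "bij_betw g {v \<in> ?V. \<chi> v = 1} {i \<in> ?I. ?g i = 1}"
    and h: "bij_betw h {v \<in> ?V. \<chi> v = -1} {i \<in> ?I. ?g i = -1}"
    by blast
  define f where "f = (\<lambda>v. if \<chi> v = 1 then g v else h v)"
  have "bij_betw f {v \<in> ?V. \<chi> v = 1} {i \<in> ?I. ?g i = 1}"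
    using g by (rule iffD1[OF bij_betw_cong, rotated]) (simp add: f_def)
  moreover have "bij_betw f {v \<in> ?V. \<chi> v = -1} {i \<in> ?I. ?g i = -1}"
    using h by (rule iffD1[OF bij_betw_cong, rotated]) (simp add: f_def)
  ultimately have "bij_betw f ({v \<in> ?V. \<chi> v = 1} \<union> {v \<in> ?V. \<chi> v = -1})
      ({i \<in> ?I. ?g i = 1} \<union> {i \<in> ?I. ?g i = -1})"
    by (rule bij_betw_combine) auto
  moreover have "{v \<in> ?V. \<chi> v = 1} \<union> {v \<in> ?V. \<chi> v = -1} = ?V" using vals by auto
  moreover have "{i \<in> ?I. ?g i = 1} \<union> {i \<in> ?I. ?g i = -1} = ?I" using gvals by auto
  ultimately have f: "bij_betw f ?V ?I" by simp
  have par: "even (f v) \<longleftrightarrow> \<chi> v = 1" if "v \<in> ?V" for v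
  proof (cases "\<chi> v = 1")
    case True
    then have "f v \<in> {i \<in> ?I. ?g i = 1}"
      using bij_betwE[OF g] that by (auto simp: f_def)
    then show ?thesis using True by (auto simp: minus_one_power_iff split: if_splits)
  next
    case False
    then have "f v \<in> {i \<in> ?I. ?g i = -1}"
      using bij_betwE[OF h] that vals[OF that] by (auto simp: f_def)
    then show ?thesis using False by (auto simp: minus_one_power_iff split: if_splits)
  qed
  have "edge_sign S {u, v} = parity_sign f u v" if e: "{u, v} \<in> edges S" for u v
  proof -
    have uv: "u \<in> ?V" "v \<in> ?V" using assms e by (auto simp: simple_graph_def)
    then show ?thesis
      using par[OF uv(1)] par[OF uv(2)] vals[OF uv(1)] vals[OF uv(2)] \<chi> e
      by (cases "edge_sign S {u, v}") (auto simp: sign_colouring_def parity_sign_def)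
  qed
  then show "parity_signed_graph S" using assms f by (auto simp: parity_signed_graph_def)
qed

lemma parity_signed_graph_iff_counts:
  assumes trav: "traversal S vs"
  defines "xs \<equiv> map (edge_sign S) (cycle_edges vs)"
  shows "parity_signed_graph S \<longleftrightarrow> even (neg_count xs) \<and> \<bar>signed_pos_count xs\<bar> \<le> 1"
proof -
  let ?n = "length vs" and ?w = "cyc_vertex vs"
  let ?c = "\<lambda>j. (-1 :: int) ^ neg_count (take j xs)"
  have n: "?n > 0" by (rule length_traversal[OF trav])
  have len: "length xs = ?n" by (simp add: xs_def)
  have nth: "xs ! j = edge_sign S (cyc_edge vs j)" if "j < ?n" for j
    using that by (simp add: xs_def nth_cycle_edges)
  have c_Suc: "?c (Suc j) = (if xs ! j = Positive then ?c j else - ?c j)" if "j < ?n" for j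
    using that len by (cases "xs ! j") (simp_all add: take_Suc_conv_app_nth)
  have sum_verts: "sum \<chi> (verts S) = (\<Sum>j<?n. \<chi> (?w j))" for \<chi> :: "'a \<Rightarrow> int"
    unfolding verts_traversal[OF trav]
    by (subst sum.reindex) (auto simp: inj_on_def cyc_vertex_eq_iff[OF trav])
  have sum_c: "(\<Sum>j<?n. ?c j) = signed_pos_count xs" if "even (neg_count xs)"
    using sum_alternating_eq_signed_pos_count[of xs] that len by simp
  show ?thesis
    unfolding parity_signed_graph_iff_colouring[OF simple_graph_traversal[OF trav]]
  proof
    assume "\<exists>\<chi>. sign_colouring S \<chi> \<and> \<bar>sum \<chi> (verts S)\<bar> \<le> 1"
    then obtain \<chi> where \<chi>: "sign_colouring S \<chi>" "\<bar>sum \<chi> (verts S)\<bar> \<le> 1" by blast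
    have w: "\<chi> (?w j) = \<chi> (?w 0) * ?c j" if "j \<le> ?n" for j
      using that
    proof (induction j)
      case (Suc j)
      have "\<chi> (?w (Suc j)) = (if xs ! j = Positive then \<chi> (?w j) else - \<chi> (?w j))"
        using \<chi>(1) cyc_edge_in_edges[OF trav, of j] nth[of j] Suc.prems
        by (simp add: sign_colouring_def cyc_edge_def)
      then show ?case using Suc c_Suc[of j] by simp
    qed simp
    have w0: "\<chi> (?w 0) = 1 \<or> \<chi> (?w 0) = -1"
      using \<chi>(1) cyc_vertex_in_verts[OF trav, of 0] by (auto simp: sign_colouring_def)
    have "?w ?n = ?w 0" by (simp add: cyc_vertex_def)
    then have ev: "even (neg_count xs)"
      using w[of ?n] w0 len by (auto simp: minus_one_power_iff split: if_splits)
    have "sum \<chi> (verts S) = \<chi> (?w 0) * signed_pos_count xs"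
      unfolding sum_verts sum_c[OF ev, symmetric] sum_distrib_left
      by (rule sum.cong[OF refl], rule w) simp
    then show "even (neg_count xs) \<and> \<bar>signed_pos_count xs\<bar> \<le> 1"
      using ev w0 \<chi>(2) by auto
  next
    assume *: "even (neg_count xs) \<and> \<bar>signed_pos_count xs\<bar> \<le> 1"
    define \<chi> where "\<chi> v = ?c (THE j. j < ?n \<and> ?w j = v)" for v
    have \<chi>w: "\<chi> (?w j) = ?c j" if "j < ?n" for j
    proof -
      have "(THE i. i < ?n \<and> ?w i = ?w j) = j"
        using that by (intro the_equality) (auto simp: cyc_vertex_eq_iff[OF trav])
      then show ?thesis by (simp add: \<chi>_def)
    qed
    have wn: "?w ?n = ?w 0" by (simp add: cyc_vertex_def)
    have \<chi>w': "\<chi> (?w j) = ?c j" if "j \<le> ?n" for j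
    proof (cases "j = ?n")
      case True
      have "\<chi> (?w ?n) = ?c 0" using \<chi>w[OF n] wn by simp
      then show ?thesis using True * len by simp
    qed (use that \<chi>w in auto)
    have "\<chi> v = (if edge_sign S {u, v} = Positive then \<chi> u else - \<chi> u)"
      if uv: "{u, v} \<in> edges S" for u v
    proof -
      obtain j where j: "j < ?n" "{u, v} = cyc_edge vs j"
        using uv by (auto simp: edges_traversal[OF trav])
      then have "\<chi> (?w (Suc j)) =
          (if edge_sign S {u, v} = Positive then \<chi> (?w j) else - \<chi> (?w j))"
        using \<chi>w'[of j] \<chi>w'[of "Suc j"] c_Suc[of j] nth[of j] by simp
      moreover have "(u = ?w j \<and> v = ?w (Suc j)) \<or> (v = ?w j \<and> u = ?w (Suc j))"
        using j(2) by (auto simp: cyc_edge_def doubleton_eq_iff)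
      ultimately show ?thesis by auto
    qed
    moreover have "\<chi> v = 1 \<or> \<chi> v = -1" for v
      by (simp add: \<chi>_def minus_one_power_iff)
    moreover have "sum \<chi> (verts S) = signed_pos_count xs"
      unfolding sum_verts using sum_c * \<chi>w by simp
    ultimately show "\<exists>\<chi>. sign_colouring S \<chi> \<and> \<bar>sum \<chi> (verts S)\<bar> \<le> 1"
      using * unfolding sign_colouring_def by (intro exI[of _ \<chi>]) simp
  qed
qed

lemma rtrancl_edge_sym:
  assumes "(x, y) \<in> {(x, y). {x, y} \<in> E}\<^sup>*"
  shows "(y, x) \<in> {(x, y). {x, y} \<in> E}\<^sup>*"
proof -
  have "sym {(x, y). {x, y} \<in> E}" by (auto simp: sym_def insert_commute)
  then show ?thesis using assms by (metis sym_rtrancl symD)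
qed

lemma connected_graphI:
  assumes "r \<in> verts G"
    and "\<And>v. v \<in> verts G \<Longrightarrow> (r, v) \<in> {(x, y). {x, y} \<in> edges G}\<^sup>*"
  shows "connected_graph G"
  unfolding connected_graph_def
proof (intro conjI ballI)
  show "verts G \<noteq> {}" using assms(1) by blast
  show "(u, v) \<in> {(x, y). {x, y} \<in> edges G}\<^sup>*" if "u \<in> verts G" "v \<in> verts G" for u v
    using rtrancl_edge_sym[OF assms(2)[OF that(1)]] assms(2)[OF that(2)] by (rule rtrancl_trans)
qed

lemma signed_section_absorbs_edge:
  assumes sec: "signed_section s S H" and simple: "simple_graph S"
    and d: "d \<in> edges S" "edge_sign S d = s" and meet: "d \<inter> verts H \<noteq> {}"
  shows "d \<in> edges H"
proof -
  obtain r where r: "r \<in> d" "r \<in> verts H" using meet by blast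
  have hom: "homogeneous_subgraph s S H" using sec by (simp add: signed_section_def)
  define H' :: "'a graph" where "H' = \<lparr>verts = verts H \<union> d, edges = insert d (edges H)\<rparr>"
  have d': "d \<subseteq> verts S" "card d = 2" using simple d by (auto simp: simple_graph_def)
  then have "finite d" by (metis card.infinite zero_neq_numeral)
  have sub: "subgraph H S" and con: "connected_graph H"
    and sg: "\<forall>e\<in>edges H. edge_sign S e = s"
    using hom by (auto simp: homogeneous_subgraph_def)
  have "simple_graph H'"
    using sub d' \<open>finite d\<close> by (auto simp: subgraph_def simple_graph_def H'_def)
  then have "subgraph H' S" "subgraph H H'"
    using sub d' d by (auto simp: subgraph_def H'_def)
  moreover have "connected_graph H'"
  proof (rule connected_graphI[of r])
    show "r \<in> verts H'" using r by (simp add: H'_def)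
    fix v assume v: "v \<in> verts H'"
    show "(r, v) \<in> {(x, y). {x, y} \<in> edges H'}\<^sup>*"
    proof (cases "v \<in> verts H")
      case True
      then have "(r, v) \<in> {(x, y). {x, y} \<in> edges H}\<^sup>*"
        using con r by (auto simp: connected_graph_def)
      moreover have "{(x, y). {x, y} \<in> edges H} \<subseteq> {(x, y). {x, y} \<in> edges H'}"
        by (auto simp: H'_def)
      ultimately show ?thesis using rtrancl_mono by blast
    next
      case False
      then have "v \<in> d" "v \<noteq> r" using v r by (auto simp: H'_def)
      then have "d = {r, v}" using r d'(2) by (auto simp: card_2_iff)
      then show ?thesis by (auto simp: H'_def)
    qed
  qed
  moreover have "\<forall>e\<in>edges H'. edge_sign S e = s" using sg d by (auto simp: H'_def)
  ultimately have "H' = H"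
    using sec by (auto simp: signed_section_def homogeneous_subgraph_def)
  then show ?thesis by (metis H'_def graph.select_convs(2) insertI1)
qed

lemma signed_section_absorbs_adjacent_edge:
  assumes "signed_section s S H" "simple_graph S" "d \<in> edges S" "edge_sign S d = s"
    and "d' \<in> edges H" "d \<inter> d' \<noteq> {}"
  shows "d \<in> edges H"
proof (rule signed_section_absorbs_edge[OF assms(1-4)])
  have "d' \<subseteq> verts H"
    using assms(1,5) by (auto simp: signed_section_def homogeneous_subgraph_def
        subgraph_def simple_graph_def)
  then show "d \<inter> verts H \<noteq> {}" using assms(6) by blast
qed

lemma homogeneous_run:
  assumes trav: "traversal S vs" and neg: "\<And>j. a \<le> j \<Longrightarrow> j < b \<Longrightarrow> edge_sign S (cyc_edge vs j) = s"
    and "a \<le> b"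
  shows "homogeneous_subgraph s S \<lparr>verts = cyc_vertex vs ` {a..b}, edges = cyc_edge vs ` {a..<b}\<rparr>"
    (is "homogeneous_subgraph s S ?H")
proof -
  have "simple_graph ?H"
    by (auto simp: simple_graph_def card_cyc_edge[OF trav]) (auto simp: cyc_edge_def)
  then have "subgraph ?H S"
    using cyc_vertex_in_verts[OF trav] cyc_edge_in_edges[OF trav] by (auto simp: subgraph_def)
  moreover have "connected_graph ?H"
  proof (rule connected_graphI[of "cyc_vertex vs a"])
    show "cyc_vertex vs a \<in> verts ?H" using \<open>a \<le> b\<close> by simp
    fix v assume "v \<in> verts ?H"
    then obtain c where c: "a \<le> c" "c \<le> b" "v = cyc_vertex vs c" by auto
    from c(1,2) have "(cyc_vertex vs a, cyc_vertex vs c) \<in> {(x, y). {x, y} \<in> edges ?H}\<^sup>*"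
    proof (induction c rule: dec_induct)
      case (step i)
      then have "(cyc_vertex vs i, cyc_vertex vs (Suc i)) \<in> {(x, y). {x, y} \<in> edges ?H}"
        by (auto simp: cyc_edge_def)
      then show ?case using step by (meson Suc_leD rtrancl.rtrancl_into_rtrancl)
    qed simp
    then show "(cyc_vertex vs a, v) \<in> {(x, y). {x, y} \<in> edges ?H}\<^sup>*" using c by simp
  qed
  ultimately show ?thesis using neg by (auto simp: homogeneous_subgraph_def)
qed

lemma odd_run_is_odd_section:
  assumes trav: "traversal S vs"
    and left: "edge_sign S (cyc_edge vs a) = Positive"
    and right: "edge_sign S (cyc_edge vs (Suc a + r)) = Positive"
    and neg: "\<And>j. j < r \<Longrightarrow> edge_sign S (cyc_edge vs (Suc a + j)) = Negative"
    and "odd r"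
  shows "\<exists>H\<in>odd_negative_sections S. edges H = cyc_edge vs ` {Suc a..<Suc a + r}"
proof -
  let ?b = "Suc a + r" and ?n = "length vs"
  define H :: "'a graph" where
    "H = \<lparr>verts = cyc_vertex vs ` {Suc a..?b}, edges = cyc_edge vs ` {Suc a..<?b}\<rparr>"
  have neg': "edge_sign S (cyc_edge vs j) = Negative" if "Suc a \<le> j" "j < ?b" for j
    using neg[of "j - Suc a"] that by simp
  have n: "?n > 0" by (rule length_traversal[OF trav])
  have "r < ?n"
  proof (rule ccontr)
    assume "\<not> r < ?n"
    then have "edge_sign S (cyc_edge vs (a + ?n)) = Negative" using neg'[of "a + ?n"] n by simp
    moreover have "cyc_edge vs (a + ?n) = cyc_edge vs a" by (simp add: cyc_edge_eq_iff[OF trav])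
    ultimately show False using left by simp
  qed
  have "inj_on (cyc_edge vs) {Suc a..<?b}"
  proof (rule linorder_inj_onI')
    fix i j assume ij: "i \<in> {Suc a..<?b}" "j \<in> {Suc a..<?b}" "i < j"
    show "cyc_edge vs i \<noteq> cyc_edge vs j"
    proof
      assume "cyc_edge vs i = cyc_edge vs j"
      then have "?n dvd j - i"
        using ij(3) mod_eq_dvd_iff_nat[of i j ?n] by (simp add: cyc_edge_eq_iff[OF trav])
      moreover have "0 < j - i" "j - i < ?n" using ij \<open>r < ?n\<close> by auto
      ultimately show False by (auto dest: dvd_imp_le)
    qed
  qed
  then have len: "graph_length H = r" by (simp add: graph_length_def H_def card_image)
  have hom: "homogeneous_subgraph Negative S H"
    unfolding H_def by (rule homogeneous_run[OF trav]) (use neg' in auto)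
  have closed: "d \<in> edges H"
    if d: "d \<in> edges S" "edge_sign S d = Negative" and x: "x \<in> d" "x \<in> verts H" for d x
  proof -
    obtain c where c: "a \<le> c" "Suc c \<le> ?b" "x = cyc_vertex vs (Suc c)"
    proof -
      obtain c' where "c' \<in> {Suc a..?b}" "x = cyc_vertex vs c'" using x by (auto simp: H_def)
      then show ?thesis using that[of "c' - 1"] by auto
    qed
    then consider "d = cyc_edge vs c" | "d = cyc_edge vs (Suc c)"
      using incident_edge_cases[OF trav d(1)] x by blast
    then show ?thesis
    proof cases
      case 1
      then have "c \<noteq> a" using left d by auto
      then show ?thesis using 1 c by (auto simp: H_def)
    next
      case 2
      then have "Suc c \<noteq> ?b" using right d by auto
      then have "Suc c \<in> {Suc a..<?b}" using c by auto
      then show ?thesis using 2 by (auto simp: H_def)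
    qed
  qed
  have "signed_section Negative S H"
    unfolding signed_section_def
  proof (intro conjI hom allI impI)
    fix H' assume "homogeneous_subgraph Negative S H' \<and> subgraph H H'"
    then have simple': "simple_graph H'" and E': "edges H' \<subseteq> edges S"
      and neg'': "\<And>e. e \<in> edges H' \<Longrightarrow> edge_sign S e = Negative"
      and con: "connected_graph H'" and VH: "verts H \<subseteq> verts H'" and EH: "edges H \<subseteq> edges H'"
      by (auto simp: homogeneous_subgraph_def subgraph_def)
    have simpleH: "simple_graph H" using hom by (simp add: homogeneous_subgraph_def subgraph_def)
    have "cyc_vertex vs (Suc a) \<in> verts H" by (simp add: H_def)
    have V: "v \<in> verts H" if "v \<in> verts H'" for v
    proof -
      have "(cyc_vertex vs (Suc a), v) \<in> {(x, y). {x, y} \<in> edges H'}\<^sup>*"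
        using con that VH \<open>cyc_vertex vs (Suc a) \<in> verts H\<close> by (auto simp: connected_graph_def)
      then show ?thesis
      proof (induction rule: rtrancl_induct)
        case base
        show ?case by fact
      next
        case (step y z)
        then have "{y, z} \<in> edges H" using closed[of "{y, z}" y] E' neg'' by auto
        then show ?case using simpleH by (auto simp: simple_graph_def)
      qed
    qed
    have "e \<in> edges H" if e: "e \<in> edges H'" for e
    proof -
      have "e \<subseteq> verts H'" "card e = 2" using simple' e by (auto simp: simple_graph_def)
      then obtain x where "x \<in> e" "x \<in> verts H" using V by (auto simp: card_2_iff)
      then show ?thesis using closed[of e x] E' neg'' e by auto
    qed
    then show "H' = H" using V VH EH by (intro graph.equality) auto
  qed
  then have "H \<in> odd_negative_sections S"
    using len \<open>odd r\<close> by (simp add: odd_negative_sections_def)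
  then show ?thesis by (intro bexI[of _ H]) (simp_all add: H_def)
qed

lemma odd_gap_meets_odd_section:
  assumes trav: "traversal S vs"
    and nth: "\<And>q. q < length xs \<Longrightarrow> edge_sign S (cyc_edge vs (p + q)) = xs ! q"
    and xs: "xs = us @ Positive # replicate r Negative @ Positive # ws" and "odd r"
  shows "\<exists>H\<in>odd_negative_sections S. \<exists>q<length xs. cyc_edge vs (p + q) \<in> edges H"
proof -
  let ?a = "p + length us"
  have "edge_sign S (cyc_edge vs ?a) = Positive"
    using nth[of "length us"] xs by simp
  moreover have "edge_sign S (cyc_edge vs (Suc ?a + r)) = Positive"
    using nth[of "Suc (length us + r)"] xs by (simp add: nth_append add.assoc)
  moreover have "edge_sign S (cyc_edge vs (Suc ?a + j)) = Negative" if "j < r" for j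
    using nth[of "Suc (length us + j)"] xs that by (simp add: nth_append add.assoc)
  ultimately obtain H where "H \<in> odd_negative_sections S"
    and "edges H = cyc_edge vs ` {Suc ?a..<Suc ?a + r}"
    using odd_run_is_odd_section[OF trav] \<open>odd r\<close> by blast
  moreover have "r > 0" using \<open>odd r\<close> by (rule odd_pos)
  ultimately have "cyc_edge vs (p + Suc (length us)) \<in> edges H" by auto
  then show ?thesis
    using \<open>H \<in> odd_negative_sections S\<close> xs
    by (intro bexI[of _ H] exI[of _ "Suc (length us)"]) auto
qed

lemma pos_count_eq_card:
  assumes "distinct es" "set es \<subseteq> edges S"
  shows "pos_count (map (edge_sign S) es) = card (positive_edges S \<inter> set es)"
proof -
  have "pos_count (map (edge_sign S) es) = length (filter (\<lambda>e. edge_sign S e = Positive) es)"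
    by (simp add: pos_count_def filter_map o_def)
  also have "\<dots> = card (set (filter (\<lambda>e. edge_sign S e = Positive) es))"
    using assms(1) by (intro distinct_card[symmetric]) simp
  also have "set (filter (\<lambda>e. edge_sign S e = Positive) es) = positive_edges S \<inter> set es"
    using assms(2) by (auto simp: positive_edges_def)
  finally show ?thesis .
qed

lemma all_negative_cycle_is_section:
  assumes trav: "traversal S vs" and neg: "\<And>e. e \<in> edges S \<Longrightarrow> edge_sign S e = Negative"
  shows "signed_section Negative S \<lparr>verts = verts S, edges = edges S\<rparr>"
proof -
  let ?n = "length vs"
  have "cyc_vertex vs ` {0..?n} = verts S"
    using verts_traversal[OF trav] cyc_vertex_in_verts[OF trav] by force
  moreover have "cyc_edge vs ` {0..<?n} = edges S"
    using edges_traversal[OF trav] by (simp add: atLeast0LessThan)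
  ultimately have "homogeneous_subgraph Negative S \<lparr>verts = verts S, edges = edges S\<rparr>"
    using homogeneous_run[OF trav, of 0 ?n Negative] neg cyc_edge_in_edges[OF trav] by simp
  then show ?thesis
    by (auto simp: signed_section_def homogeneous_subgraph_def subgraph_def
        intro!: graph.equality)
qed

lemma parity_signed_graph_without_odd_sections:
  assumes cyc: "cycle_graph S" and none: "odd_negative_sections S = {}"
  shows "parity_signed_graph S \<longleftrightarrow>
    (even (graph_length S) \<and> (\<forall>e\<in>edges S. edge_sign S e = Negative)) \<or>
    (odd (graph_length S) \<and> card (positive_edges S) = 1)"
proof (cases "\<forall>e\<in>edges S. edge_sign S e = Negative")
  case True
  obtain vs where trav: "traversal S vs" using cyc by (auto simp: cycle_graph_def)
  have "even (graph_length S)"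
    using all_negative_cycle_is_section[OF trav] none True
    by (auto simp: odd_negative_sections_def graph_length_def)
  moreover have xs: "map (edge_sign S) (cycle_edges vs) = replicate (length vs) Negative"
    using True cyc_edge_in_edges[OF trav] by (auto simp: cycle_edges_eq intro: replicate_eqI)
  moreover have "parity_signed_graph S"
    unfolding parity_signed_graph_iff_counts[OF trav] xs
    using calculation(1) by (simp add: graph_length_def card_edges_traversal[OF trav])
  ultimately show ?thesis using True by simp
next
  case False
  obtain us where us: "traversal S us" using cyc by (auto simp: cycle_graph_def)
  then obtain p where p: "p < length us" "edge_sign S (cyc_edge us p) = Positive"
    using False by (auto simp: edges_traversal[OF us]) (metis sign.exhaust)
  define vs where "vs = rotate p us"
  have trav: "traversal S vs" unfolding vs_def by (rule traversal_rotate[OF us])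
  let ?n = "length vs"
  define xs where "xs = map (edge_sign S) (cycle_edges vs)"
  have n: "?n > 0" by (rule length_traversal[OF trav])
  have "cyc_edge vs 0 = cycle_edges vs ! 0"
    using n by (simp only: nth_cycle_edges)
  also have "\<dots> = cyc_edge us p"
    unfolding vs_def cycle_edges_rotate
    using p(1) nth_rotate[of 0 "cycle_edges us" p] length_traversal[OF us]
    by (simp add: nth_cycle_edges)
  finally have e0: "edge_sign S (cyc_edge vs 0) = Positive" using p(2) by simp
  have len: "length xs = ?n" by (simp add: xs_def)
  have nth: "edge_sign S (cyc_edge vs (0 + q)) = (xs @ [Positive]) ! q"
    if "q < length (xs @ [Positive])" for q
  proof (cases "q = ?n")
    case True
    then have "cyc_edge vs q = cyc_edge vs 0" by (simp add: cyc_edge_eq_iff[OF trav])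
    then show ?thesis using True e0 len by (simp add: nth_append)
  next
    case False
    then show ?thesis using that len by (simp add: nth_append xs_def nth_cycle_edges)
  qed
  have "even (neg_count (xs @ [Positive])) \<and>
      signed_pos_count (xs @ [Positive]) = int (pos_count (xs @ [Positive]))"
  proof (rule even_gaps_counts)
    show "hd (xs @ [Positive]) = Positive \<and> last (xs @ [Positive]) = Positive"
      using nth[of 0] e0 by (simp add: hd_conv_nth)
    show "even r" if "xs @ [Positive] = us' @ Positive # replicate r Negative @ Positive # ws"
      for us' r ws
      using odd_gap_meets_odd_section[OF trav nth that] none by blast
  qed
  then have counts: "even (neg_count xs)" "signed_pos_count xs = int (pos_count xs)" by auto
  have E: "set (cycle_edges vs) = edges S" using trav by (simp add: traversal_def)
  have pos: "pos_count xs = card (positive_edges S)"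
    unfolding xs_def pos_count_eq_card[OF distinct_cycle_edges[OF trav] E[THEN equalityD1]] E
    by (rule arg_cong[where f = card]) (auto simp: positive_edges_def)
  have gl: "pos_count xs + neg_count xs = graph_length S"
    using pos_count_plus_neg_count[of xs] len
    by (simp add: graph_length_def card_edges_traversal[OF trav])
  have "pos_count xs > 0"
  proof -
    have "xs = Positive # tl xs" using nth[of 0] e0 len n by (cases xs) auto
    then show ?thesis by (metis pos_count_simps(2) zero_less_Suc)
  qed
  have "parity_signed_graph S \<longleftrightarrow> pos_count xs \<le> 1"
    using parity_signed_graph_iff_counts[OF trav] counts unfolding xs_def[symmetric] by simp
  also have "\<dots> \<longleftrightarrow> odd (graph_length S) \<and> pos_count xs = 1"
    using gl counts(1) \<open>pos_count xs > 0\<close> by (auto simp flip: gl)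
  finally show ?thesis using False pos by metis
qed

lemma nth_concat_block:
  assumes "cycle_edges vs = L @ es @ R" "q < length es"
  shows "es ! q = cyc_edge vs (length L + q)"
proof -
  have "length vs = length L + length es + length R"
    using arg_cong[OF assms(1), of length] by simp
  then have "cyc_edge vs (length L + q) = cycle_edges vs ! (length L + q)"
    using assms(2) by (simp add: nth_cycle_edges)
  then show ?thesis using assms by (simp add: nth_append)
qed

lemma cyc_edge_consecutive_meet: "cyc_edge vs i \<inter> cyc_edge vs (Suc i) \<noteq> {}"
  by (auto simp: cyc_edge_def)

lemma sum_alternating_eq_even_minus_odd:
  fixes m :: "nat \<Rightarrow> nat"
  shows "(\<Sum>i\<in>{1..k}. (-1) ^ i * int (m i)) =
    int (\<Sum>i | i \<in> {1..k} \<and> even i. m i) - int (\<Sum>i | i \<in> {1..k} \<and> odd i. m i)"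
proof -
  have "(\<Sum>i\<in>{1..k}. (-1) ^ i * int (m i)) =
      (\<Sum>i\<in>{1..k}. (if even i then int (m i) else 0) - (if odd i then int (m i) else 0))"
    by (rule sum.cong) auto
  also have "\<dots> = (\<Sum>i\<in>{1..k}. if even i then int (m i) else 0) -
      (\<Sum>i\<in>{1..k}. if odd i then int (m i) else 0)"
    by (rule sum_subtractf)
  also have "\<dots> = (\<Sum>i\<in>{i \<in> {1..k}. even i}. int (m i)) - (\<Sum>i\<in>{i \<in> {1..k}. odd i}. int (m i))"
    by (simp only: sum.inter_filter[OF finite_atLeastAtMost])
  finally show ?thesis by simp
qed

lemma parity_signed_graph_with_odd_sections:
  assumes bij: "bij_betw N {1..k} (odd_negative_sections S)"
    and k: "k > 0" and ord: "in_cyclic_order S k N P"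
    and m: "\<And>i. i \<in> {1..k} \<Longrightarrow> m i = card (positive_edges S \<inter> set (P i))"
  shows "parity_signed_graph S \<longleftrightarrow> even k \<and> \<bar>\<Sum>i\<in>{1..k}. (-1) ^ i * int (m i)\<bar> \<le> 1"
proof -
  obtain vs A where trav: "traversal S vs"
    and A: "\<And>i. i \<in> {1..k} \<Longrightarrow> set (A i) = edges (N i)"
    and ce: "cycle_edges vs = concat (map (\<lambda>i. A i @ P i) [1..<Suc k])"
    using ord unfolding in_cyclic_order_def by blast
  define L where "L j = concat (map (\<lambda>i. A i @ P i) [1..<Suc j])" for j
  define R where "R i = concat (map (\<lambda>i. A i @ P i) [Suc i..<Suc k])" for i
  have L0: "L 0 = []" and L_Suc: "L (Suc j) = L j @ A (Suc j) @ P (Suc j)" for j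
    by (simp_all add: L_def)
  have split: "cycle_edges vs = L (i - 1) @ A i @ P i @ R i" if i: "i \<in> {1..k}" for i
  proof -
    have "[1..<Suc k] = [1..<i] @ i # [Suc i..<Suc k]"
      using i upt_add_eq_append[of 1 i "Suc k - i"] upt_conv_Cons[of i "Suc k"]
      by (simp del: upt_Suc)
    then show ?thesis unfolding ce L_def R_def using i by (simp del: upt_Suc)
  qed
  have dist: "distinct (cycle_edges vs)" by (rule distinct_cycle_edges[OF trav])
  have E: "set (cycle_edges vs) = edges S" using trav by (simp add: traversal_def)
  have simple: "simple_graph S" by (rule simple_graph_traversal[OF trav])
  have N: "signed_section Negative S (N i)" "odd (graph_length (N i))" if "i \<in> {1..k}" for i
    using bij_betwE[OF bij] that by (auto simp: odd_negative_sections_def)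
  have disj: "set (A l) \<inter> set (P i) = {}" if i: "i \<in> {1..k}" and l: "l \<in> {1..k}" for i l
  proof -
    consider "l < i" | "l = i" | "l > i" by linarith
    then show ?thesis
    proof cases
      case 1
      then have "set (A l) \<subseteq> set (L (i - 1))" using l i by (force simp: L_def)
      then show ?thesis using dist unfolding split[OF i] by auto
    next
      case 2
      then show ?thesis using dist unfolding split[OF i] by auto
    next
      case 3
      then have "set (A l) \<subseteq> set (R i)" using l i by (force simp: R_def)
      then show ?thesis using dist unfolding split[OF i] by auto
    qed
  qed
  have A_odd: "odd (length (A i))" if i: "i \<in> {1..k}" for i
  proof -
    have "distinct (A i)" using dist unfolding split[OF i] by simp
    then show ?thesis using N(2)[OF i] A[OF i] distinct_card[of "A i"] by (simp add: graph_length_def)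
  qed
  then have A_ne: "A i \<noteq> []" if "i \<in> {1..k}" for i using that by fastforce
  have A_signs: "map (edge_sign S) (A i) = replicate (length (A i)) Negative" if i: "i \<in> {1..k}" for i
    using N(1)[OF i] A[OF i]
    by (auto simp: signed_section_def homogeneous_subgraph_def intro!: replicate_eqI)
  have P_boundary: "edge_sign S d = Positive"
    if i: "i \<in> {1..k}" and d: "d \<in> set (P i)" and l: "l \<in> {1..k}" and d': "d' \<in> set (A l)"
      and meet: "d \<inter> d' \<noteq> {}" for i d l d'
  proof (rule ccontr)
    assume "edge_sign S d \<noteq> Positive"
    then have "edge_sign S d = Negative" by (cases "edge_sign S d") auto
    moreover have "d \<in> edges S" using d split[OF i] E by auto
    ultimately have "d \<in> set (A l)"
      using signed_section_absorbs_adjacent_edge[OF N(1)[OF l] simple] d' meet A[OF l] by blast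
    then show False using disj[OF i l] d by blast
  qed
  have P_counts: "even (neg_count (map (edge_sign S) (P i))) \<and>
      signed_pos_count (map (edge_sign S) (P i)) = int (m i)" if i: "i \<in> {1..k}" for i
  proof -
    let ?t = "length (L (i - 1) @ A i)"
    have nthP: "P i ! q = cyc_edge vs (?t + q)" if "q < length (P i)" for q
      using nth_concat_block[of vs "L (i - 1) @ A i" "P i" "R i" q] split[OF i] that by simp
    have gaps: "even (neg_count (map (edge_sign S) (P i))) \<and>
      signed_pos_count (map (edge_sign S) (P i)) = int (pos_count (map (edge_sign S) (P i)))"
    proof (rule even_gaps_counts)
      assume "map (edge_sign S) (P i) \<noteq> []"
      then have ne: "P i \<noteq> []" by simp
      have "hd (P i) = cyc_edge vs ?t" using nthP[of 0] ne by (simp add: hd_conv_nth)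
      moreover have "last (A i) = cyc_edge vs (?t - 1)"
        using nth_concat_block[of vs "L (i - 1)" "A i" "P i @ R i" "length (A i) - 1"]
          split[OF i] A_ne[OF i] by (simp add: last_conv_nth Suc_leI)
      moreover have "Suc (?t - 1) = ?t" using A_ne[OF i] by (cases "A i") auto
      ultimately have "hd (P i) \<inter> last (A i) \<noteq> {}"
        using cyc_edge_consecutive_meet[of vs "?t - 1"] by (simp add: Int_commute)
      then have hd: "edge_sign S (hd (P i)) = Positive"
        using P_boundary[OF i _ i, of "hd (P i)" "last (A i)"] ne A_ne[OF i] by simp
      let ?u = "?t + length (P i)"
      have "last (P i) = cyc_edge vs (?u - 1)"
        using nthP[of "length (P i) - 1"] ne by (simp add: last_conv_nth Suc_leI)
      moreover have "Suc (?u - 1) = ?u" using ne by (cases "P i") auto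
      ultimately have meet: "last (P i) \<inter> cyc_edge vs ?u \<noteq> {}"
        using cyc_edge_consecutive_meet[of vs "?u - 1"] by simp
      have "\<exists>l\<in>{1..k}. cyc_edge vs ?u \<in> set (A l)"
      proof (cases "i = k")
        case True
        then have "R i = []" by (simp add: R_def)
        then have "?u = length vs" using arg_cong[OF split[OF i], of length] by simp
        then have "cyc_edge vs ?u = cyc_edge vs 0" by (simp add: cyc_edge_eq_iff[OF trav])
        moreover have 1: "1 \<in> {1..k}" using k by simp
        moreover have "A 1 ! 0 = cyc_edge vs 0"
          using nth_concat_block[of vs "[]" "A 1" "P 1 @ R 1" 0] split[OF 1] A_ne[OF 1]
          by (simp add: L0)
        ultimately show ?thesis using A_ne[OF 1] by (metis length_greater_0_conv nth_mem)
      next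
        case False
        then have i': "Suc i \<in> {1..k}" using i by simp
        have "L i = L (i - 1) @ A i @ P i" using L_Suc[of "i - 1"] i by simp
        then have "A (Suc i) ! 0 = cyc_edge vs ?u"
          using nth_concat_block[of vs "L i" "A (Suc i)" "P (Suc i) @ R (Suc i)" 0]
            split[OF i'] A_ne[OF i'] by (simp add: add.assoc)
        then show ?thesis using i' A_ne[OF i'] by (metis length_greater_0_conv nth_mem)
      qed
      then have "edge_sign S (last (P i)) = Positive"
        using P_boundary[OF i] ne meet by (meson last_in_set)
      then show "hd (map (edge_sign S) (P i)) = Positive \<and>
          last (map (edge_sign S) (P i)) = Positive"
        using hd ne by (simp add: hd_map last_map)
    next
      fix us r ws
      assume xs: "map (edge_sign S) (P i) = us @ Positive # replicate r Negative @ Positive # ws"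
      show "even r"
      proof (rule ccontr)
        assume "odd r"
        have nth: "edge_sign S (cyc_edge vs (?t + q)) = map (edge_sign S) (P i) ! q"
          if "q < length (map (edge_sign S) (P i))" for q
          using nthP[of q] that by simp
        obtain H q where H: "H \<in> odd_negative_sections S" "q < length (P i)"
          "cyc_edge vs (?t + q) \<in> edges H"
          using odd_gap_meets_odd_section[OF trav nth xs \<open>odd r\<close>] by auto
        obtain l where l: "l \<in> {1..k}" "H = N l"
          using H(1) bij by (metis bij_betw_imp_surj_on imageE)
        then have "P i ! q \<in> set (A l) \<inter> set (P i)"
          using H nthP[of q] A[OF l(1)] nth_mem[OF H(2)] by simp
        then show False using disj[OF i l(1)] by blast
      qed
    qed
    have "distinct (P i)" "set (P i) \<subseteq> edges S"
      using dist E unfolding split[OF i] by auto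
    then show ?thesis using gaps m[OF i] by (simp add: pos_count_eq_card)
  qed
  have L_counts: "(even (neg_count (map (edge_sign S) (L j))) \<longleftrightarrow> even j) \<and>
      signed_pos_count (map (edge_sign S) (L j)) = (\<Sum>i\<in>{1..j}. (-1) ^ i * int (m i))"
    if "j \<le> k" for j
    using that
  proof (induction j)
    case (Suc j)
    then have j: "Suc j \<in> {1..k}" by simp
    show ?case
      using Suc P_counts[OF j] A_odd[OF j]
      by (simp add: L_Suc A_signs[OF j] minus_one_power_iff)
  qed (simp add: L0)
  show ?thesis
    using parity_signed_graph_iff_counts[OF trav] L_counts[of k] ce by (simp add: L_def)
qed

theorem theorem3:
  fixes C :: "'a signed_graph"
    and k :: nat
    and N :: "nat \<Rightarrow> 'a graph"
    and P :: "nat \<Rightarrow> 'a set list"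
    and m :: "nat \<Rightarrow> nat"
    and m_o m_e :: nat
  assumes "cycle_graph C"
    and "bij_betw N {1..k} (odd_negative_sections C)"
    and "k > 0 \<Longrightarrow> in_cyclic_order C k N P"
    and "\<And>i. i \<in> {1..k} \<Longrightarrow> m i = card (positive_edges C \<inter> set (P i))"
    and "m_o = (\<Sum>i | i \<in> {1..k} \<and> odd i. m i)"
    and "m_e = (\<Sum>i | i \<in> {1..k} \<and> even i. m i)"
  shows "parity_signed_graph C \<longleftrightarrow>
    even k \<and>
    ((k = 0 \<and>
        ((even (graph_length C) \<and> (\<forall>e\<in>edges C. edge_sign C e = Negative)) \<or>
         (odd (graph_length C) \<and> card (positive_edges C) = 1))) \<or>
     (k > 0 \<and> \<bar>int m_o - int m_e\<bar> \<le> 1))"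
proof (cases "k = 0")
  case True
  then have "odd_negative_sections C = {}" using assms(2) by (simp add: bij_betw_def)
  then show ?thesis
    using parity_signed_graph_without_odd_sections[OF assms(1)] True by simp
next
  case False
  have "parity_signed_graph C \<longleftrightarrow> even k \<and> \<bar>int m_e - int m_o\<bar> \<le> 1"
    using parity_signed_graph_with_odd_sections[OF assms(2) _ assms(3,4)] False
    unfolding sum_alternating_eq_even_minus_odd assms(5,6) by simp
  then show ?thesis using False by (simp add: abs_minus_commute)
qed

end
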